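(* Let $N\ge 2$, let $U$ be a nonempty set, and let $f=(f_1,\dots,f_N)$ with $f_i\colon U\to\mathbb{R}\cup\{+\infty\}$ for $i=1,\dots,N$, such that $\operatorname{dom} f\neq\varnothing$. For $\lambda\in\Delta_N^\circ$ let $H_\lambda(u)=\sum_{i=1}^N\lambda_i f_i(u)$ and $V(\lambda)=\inf_{u\in U}H_\lambda(u)$. Then, for almost every $\lambda\in\Delta_N^\circ$, the following property holds: if $V(\lambda)>-\infty$, then there exists a vector $y_\lambda=(y_{\lambda,1},\dots,y_{\lambda,N})\in[-\infty,+\infty]^N$ such that, for every minimizing sequence $(u_k)_{k\in\mathbb{N}}$ for $H_\lambda$, $$\lim_{k\to\infty}f_i(u_k)=y_{\lambda,i}\qquad\text{for every } i=1,\dots,N.$$ In particular, the limiting objective vector is uniquely determined by $\lambda$ and does not depend on the chosen minimizing sequence.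
   Context: $U$ is an arbitrary nonempty set; no topology, convexity, compactness or lower semicontinuity is assumed. The domain is $\operatorname{dom} f=\{u\in U: f_i(u)<+\infty \text{ for every } i=1,\dots,N\}$. The open simplex is $\Delta_N^\circ=\{\lambda\in(0,+\infty)^N:\sum_{i=1}^N\lambda_i=1\}$. "Almost every $\lambda\in\Delta_N^\circ$" is with respect to the natural $(N-1)$-dimensional Lebesgue measure on $\Delta_N^\circ$. A sequence $(u_k)_{k\in\mathbb{N}}\subset U$ is a minimizing sequence for $H_\lambda$ if $H_\lambda(u_k)\to V(\lambda)$ as $k\to\infty$. Limits of $f_i(u_k)$ are taken in the extended reals $[-\infty,+\infty]$. A sum with a term equal to $+\infty$ is $+\infty$. *)

theory Defs
  imports "HOL-Analysis.Analysis"
begin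

definition open_simplex :: "nat \<Rightarrow> (nat \<Rightarrow> real) set" where
  "open_simplex N = {l \<in> {1..N} \<rightarrow>\<^sub>E {0<..}. (\<Sum>i=1..N. l i) = 1}"

text \<open>The affine chart that reconstructs a point of the hyperplane of coordinate sum one from its
  first \<open>N - 1\<close> coordinates.\<close>

definition simplex_chart :: "nat \<Rightarrow> (nat \<Rightarrow> real) \<Rightarrow> (nat \<Rightarrow> real)" where
  "simplex_chart N x = (\<lambda>i\<in>{1..N}. if i = N then 1 - (\<Sum>j\<in>{1..<N}. x j) else x i)"

definition chart_domain :: "nat \<Rightarrow> (nat \<Rightarrow> real) set" where
  "chart_domain N = {x \<in> {1..<N} \<rightarrow>\<^sub>E UNIV. simplex_chart N x \<in> open_simplex N}"

text \<open>The \<open>(N - 1)\<close>-dimensional Lebesgue (surface) measure on the open simplex: the image of Lebesgue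
  measure under the chart, with the constant Gram factor \<open>sqrt N\<close> of the chart. It is a Borel
  measure; the quantifier \<open>AE\<close> only asks that the exceptional set be contained in a measurable null
  set, so passing to the completion would not change it.\<close>

definition simplex_measure :: "nat \<Rightarrow> (nat \<Rightarrow> real) measure" where
  "simplex_measure N =
     scale_measure (ennreal (sqrt (real N)))
       (distr (restrict_space (Pi\<^sub>M {1..<N} (\<lambda>_. lborel)) (chart_domain N))
              (restrict_space (Pi\<^sub>M {1..N} (\<lambda>_. borel)) (open_simplex N))
              (simplex_chart N))"

text \<open>The value of \<^const>\<open>distr\<close> is only meaningful for a measurable map, and that of
  \<^const>\<open>restrict_space\<close> for a measurable set; both are checked here.\<close>

lemma simplex_chart_measurable_PiM:
  "simplex_chart N \<in> Pi\<^sub>M {1..<N} (\<lambda>_. lborel) \<rightarrow>\<^sub>M Pi\<^sub>M {1..N} (\<lambda>_. borel)"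
  unfolding simplex_chart_def
proof (rule measurable_restrict)
  fix i assume i: "i \<in> {1..N}"
  show "(\<lambda>x. if i = N then 1 - (\<Sum>j\<in>{1..<N}. x j) else x i :: real)
      \<in> Pi\<^sub>M {1..<N} (\<lambda>_. lborel) \<rightarrow>\<^sub>M borel"
  proof (cases "i = N")
    case True
    have "(\<lambda>x. 1 - (\<Sum>j\<in>{1..<N}. x j)) \<in> Pi\<^sub>M {1..<N} (\<lambda>_. lborel) \<rightarrow>\<^sub>M (borel :: real measure)"
      by (intro borel_measurable_diff borel_measurable_const borel_measurable_sum)
         (metis measurable_component_singleton measurable_lborel1)
    then show ?thesis using True by simp
  next
    case False
    then have "i \<in> {1..<N}" using i by auto
    then have "(\<lambda>x. x i) \<in> Pi\<^sub>M {1..<N} (\<lambda>_. lborel) \<rightarrow>\<^sub>M (borel :: real measure)"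
      by (metis measurable_component_singleton measurable_lborel1)
    then show ?thesis using False by simp
  qed
qed

lemma open_simplex_sets: "open_simplex N \<in> sets (Pi\<^sub>M {1..N} (\<lambda>_. borel))"
proof -
  have *: "(\<lambda>l. \<Sum>i=1..N. l i) \<in> borel_measurable (Pi\<^sub>M {1..N} (\<lambda>_. borel :: real measure))"
    by (intro borel_measurable_sum measurable_component_singleton)
  have "open_simplex N = (\<Pi>\<^sub>E i\<in>{1..N}. {0<..}) \<inter>
      ((\<lambda>l. \<Sum>i=1..N. l i) -` {1} \<inter> space (Pi\<^sub>M {1..N} (\<lambda>_. borel :: real measure)))"
    by (auto simp: open_simplex_def space_PiM PiE_def)
  also have "\<dots> \<in> sets (Pi\<^sub>M {1..N} (\<lambda>_. borel))"
    by (intro sets.Int sets_PiM_I_finite measurable_sets[OF *]) auto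
  finally show ?thesis .
qed

lemma chart_domain_sets: "chart_domain N \<in> sets (Pi\<^sub>M {1..<N} (\<lambda>_. lborel))"
proof -
  have "chart_domain N =
      simplex_chart N -` open_simplex N \<inter> space (Pi\<^sub>M {1..<N} (\<lambda>_. lborel :: real measure))"
    by (auto simp: chart_domain_def space_PiM)
  then show ?thesis
    using measurable_sets[OF simplex_chart_measurable_PiM open_simplex_sets] by simp
qed

lemma simplex_chart_measurable:
  "simplex_chart N \<in> restrict_space (Pi\<^sub>M {1..<N} (\<lambda>_. lborel)) (chart_domain N)
     \<rightarrow>\<^sub>M restrict_space (Pi\<^sub>M {1..N} (\<lambda>_. borel)) (open_simplex N)"
  by (rule measurable_restrict_space3[OF simplex_chart_measurable_PiM])
     (auto simp: chart_domain_def)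

lemma space_simplex_measure: "space (simplex_measure N) = open_simplex N"
proof -
  have "open_simplex N \<subseteq> space (Pi\<^sub>M {1..N} (\<lambda>_. borel))"
    by (rule sets.sets_into_space[OF open_simplex_sets])
  then show ?thesis
    by (simp only: simplex_measure_def space_scale_measure space_distr space_restrict_space) blast
qed

lemma emeasure_simplex_measure:
  assumes A: "A \<in> sets (Pi\<^sub>M {1..N} (\<lambda>_. borel))" "A \<subseteq> open_simplex N"
  shows "emeasure (simplex_measure N) A = ennreal (sqrt (real N)) *
    emeasure (Pi\<^sub>M {1..<N} (\<lambda>_. lborel)) {x \<in> {1..<N} \<rightarrow>\<^sub>E UNIV. simplex_chart N x \<in> A}"
proof -
  let ?P = "Pi\<^sub>M {1..<N} (\<lambda>_. lborel :: real measure)"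
  let ?R = "restrict_space ?P (chart_domain N)"
  let ?B = "{x \<in> {1..<N} \<rightarrow>\<^sub>E UNIV. simplex_chart N x \<in> A}"
  have 1: "A \<in> sets (restrict_space (Pi\<^sub>M {1..N} (\<lambda>_. borel)) (open_simplex N))"
    using A by (auto simp: sets_restrict_space)
  have 2: "simplex_chart N -` A \<inter> space ?R = ?B"
    using A by (auto simp: space_restrict_space space_PiM chart_domain_def)
  have 3: "?B \<subseteq> chart_domain N"
    using A by (auto simp: chart_domain_def)
  have 4: "emeasure ?R ?B = emeasure ?P ?B"
    by (intro emeasure_restrict_space 3 sets.Int chart_domain_sets sets.top)
  show ?thesis
    unfolding simplex_measure_def emeasure_scale_measure
      emeasure_distr[OF simplex_chart_measurable 1] 2 4 ..
qed

definition dom_f :: "nat \<Rightarrow> 'a set \<Rightarrow> (nat \<Rightarrow> 'a \<Rightarrow> ereal) \<Rightarrow> 'a set" where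
  "dom_f N U f = {u \<in> U. \<forall>i\<in>{1..N}. f i u < \<infinity>}"

definition weighted_sum :: "nat \<Rightarrow> (nat \<Rightarrow> 'a \<Rightarrow> ereal) \<Rightarrow> (nat \<Rightarrow> real) \<Rightarrow> 'a \<Rightarrow> ereal" where
  "weighted_sum N f l u = (\<Sum>i=1..N. ereal (l i) * f i u)"

definition weighted_value :: "nat \<Rightarrow> 'a set \<Rightarrow> (nat \<Rightarrow> 'a \<Rightarrow> ereal) \<Rightarrow> (nat \<Rightarrow> real) \<Rightarrow> ereal" where
  "weighted_value N U f l = (INF u\<in>U. weighted_sum N f l u)"

definition minimizing_seq ::
    "nat \<Rightarrow> 'a set \<Rightarrow> (nat \<Rightarrow> 'a \<Rightarrow> ereal) \<Rightarrow> (nat \<Rightarrow> real) \<Rightarrow> (nat \<Rightarrow> 'a) \<Rightarrow> bool" where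
  "minimizing_seq N U f l u \<longleftrightarrow>
     (\<forall>k. u k \<in> U) \<and> (\<lambda>k. weighted_sum N f l (u k)) \<longlonglongrightarrow> weighted_value N U f l"

end

theory Submission
  imports Defs
begin

text \<open>
  For \<open>u\<close> in the domain, the identity \<open>\<Sum>i. l i = 1\<close> turns \<open>H\<^sub>l u\<close> into
  \<open>f\<^sub>N u + (\<Sum>j<N. l j * (f\<^sub>j u - f\<^sub>N u))\<close>, an affine function of the first \<open>N - 1\<close> weights
  whose slope in direction \<open>j\<close> is the gap \<open>f\<^sub>j u - f\<^sub>N u\<close>. The value \<open>V\<close> is the infimum of these
  affine functions. If all gaps converge to finite limits along a minimizing sequence, so does
  \<open>f\<^sub>N\<close>, being \<open>H\<^sub>l\<close> minus a combination of gaps, and hence so does every objective. So it is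
  enough to control one slope of the near-minimizers at a time.

  Differentiability of concave functions is replaced by a two-point argument. Suppose that at \<open>l\<close>, with
  \<open>V l\<close> finite, the limits of the \<open>j\<close>-th gap are not unique. Then for some rationals \<open>p < q\<close> the
  infimum \<open>V l\<close> can be reached both with gaps at most \<open>p\<close> and with gaps at least \<open>q\<close>.
  If two such weights \<open>l\<close>, \<open>l'\<close> differ only in coordinate \<open>j\<close> (and in the dependent coordinate
  \<open>N\<close>), with \<open>t = l' j - l j > 0\<close>, then moving near-minimizers of one weight to the other gives
  \<open>V l' \<le> V l + t * p\<close> and \<open>V l \<le> V l' - t * q\<close>, which is absurd. Thus for fixed \<open>j, p, q\<close> the
  bad weights meet every line in direction \<open>j\<close> in at most one point. They form a Borel set, because
  an infimum of affine functions is upper semicontinuous, and Fubini makes it null. The same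
  argument disposes of the weights at which the gap can be driven to \<open>\<infinity>\<close> or to \<open>-\<infinity>\<close>; these lie
  on the boundary of the region where \<open>V > -\<infinity>\<close>.

  The key estimate is \<open>value_change_le\<close>; the null sets are \<open>null_slope_jump\<close> and \<open>null_steep\<close>;
  the convergence away from them is \<open>near_minimizers_gap_converges\<close>.
\<close>

section \<open>Sets that meet parallel lines in at most one point\<close>

lemma null_sets_PiM_lborel_if_thin_lines:
  fixes B :: "('i \<Rightarrow> real) set"
  assumes I: "finite I" "j \<in> I"
    and B: "B \<in> sets (Pi\<^sub>M I (\<lambda>_. lborel))"
    and thin: "\<And>x a b. x(j := a) \<in> B \<Longrightarrow> x(j := b) \<in> B \<Longrightarrow> a = b"
  shows "B \<in> null_sets (Pi\<^sub>M I (\<lambda>_. lborel))"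
proof -
  let ?J = "I - {j}"
  interpret product_sigma_finite "\<lambda>_ :: 'i. lborel :: real measure" ..
  have I_eq: "I = insert j ?J"
    using I by blast
  have line_null: "(\<integral>\<^sup>+ a. indicator B (x(j := a)) \<partial>lborel) = 0" for x
  proof -
    have "\<exists>c. {a. x(j := a) \<in> B} \<subseteq> {c}"
      using thin by blast
    then have "countable {a. x(j := a) \<in> B}"
      by (metis countable_empty countable_insert countable_subset)
    then have "AE a in lborel. x(j := a) \<notin> B"
      by (intro AE_I'[OF countable_imp_null_set_lborel]) auto
    then have "(\<integral>\<^sup>+ a. indicator B (x(j := a)) \<partial>lborel) = (\<integral>\<^sup>+ a. 0 \<partial>(lborel :: real measure))"
      by (intro nn_integral_cong_AE) (auto elim: eventually_mono)
    then show ?thesis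
      by simp
  qed
  have "emeasure (Pi\<^sub>M I (\<lambda>_. lborel)) B = (\<integral>\<^sup>+ x. indicator B x \<partial>Pi\<^sub>M (insert j ?J) (\<lambda>_. lborel))"
    using B I_eq by simp
  also have "\<dots> = (\<integral>\<^sup>+ x. \<integral>\<^sup>+ a. indicator B (x(j := a)) \<partial>lborel \<partial>Pi\<^sub>M ?J (\<lambda>_. lborel))"
    using I B I_eq by (intro product_nn_integral_insert) auto
  also have "\<dots> = 0"
    by (simp add: line_null)
  finally show ?thesis
    using B by blast
qed

text \<open>In the chart, the lines parallel to a coordinate axis are the families of weights that agree
  in all but one of the first \<open>N - 1\<close> coordinates; the last coordinate is determined by the others.\<close>

lemma null_sets_simplex_measure_if_thin_lines:
  assumes A: "A \<in> sets (Pi\<^sub>M {1..N} (\<lambda>_. borel))" "A \<subseteq> open_simplex N"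
    and j: "j \<in> {1..<N}"
    and thin: "\<And>l l'. l \<in> A \<Longrightarrow> l' \<in> A \<Longrightarrow> \<forall>i\<in>{1..<N} - {j}. l' i = l i \<Longrightarrow> \<not> l j < l' j"
  shows "A \<in> null_sets (simplex_measure N)"
proof -
  let ?P = "Pi\<^sub>M {1..<N} (\<lambda>_. lborel :: real measure)"
  let ?B = "{x \<in> {1..<N} \<rightarrow>\<^sub>E UNIV. simplex_chart N x \<in> A}"
  have "?B = simplex_chart N -` A \<inter> space ?P"
    by (auto simp: space_PiM)
  then have B: "?B \<in> sets ?P"
    using measurable_sets[OF simplex_chart_measurable_PiM A(1)] by simp
  have "?B \<in> null_sets ?P"
  proof (rule null_sets_PiM_lborel_if_thin_lines[OF _ j B])
    fix x a b
    assume *: "x(j := a) \<in> ?B" "x(j := b) \<in> ?B"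
    have chart: "simplex_chart N y i = y i" if "i \<in> {1..<N}" for y i
      using that by (auto simp: simplex_chart_def)
    have "\<not> a < b" if "x(j := a) \<in> ?B" "x(j := b) \<in> ?B" for a b
      using thin[of "simplex_chart N (x(j := a))" "simplex_chart N (x(j := b))"] that j
      by (simp add: chart)
    from this[of a b] this[of b a] * show "a = b"
      by force
  qed simp
  then have "emeasure (simplex_measure N) A = 0"
    unfolding emeasure_simplex_measure[OF A] by (simp add: null_setsD1)
  moreover have "A \<in> sets (simplex_measure N)"
    using A by (auto simp: simplex_measure_def sets_restrict_space)
  ultimately show ?thesis
    by blast
qed

section \<open>The value as an infimum of affine functions\<close>

locale weighted_objectives =
  fixes N :: nat and U :: "'a set" and f :: "nat \<Rightarrow> 'a \<Rightarrow> ereal"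
  assumes two_objectives: "N \<ge> 2"
    and proper: "\<And>i u. i \<in> {1..N} \<Longrightarrow> u \<in> U \<Longrightarrow> f i u \<noteq> -\<infinity>"
    and dom_nonempty: "dom_f N U f \<noteq> {}"
begin

abbreviation "D \<equiv> dom_f N U f"
abbreviation "V S \<equiv> weighted_value N S f"

definition rf :: "nat \<Rightarrow> 'a \<Rightarrow> real" where
  "rf i u = real_of_ereal (f i u)"

definition gap :: "nat \<Rightarrow> 'a \<Rightarrow> real" where
  "gap j u = rf j u - rf N u"

lemma f_eq_rf: "u \<in> D \<Longrightarrow> i \<in> {1..N} \<Longrightarrow> f i u = ereal (rf i u)"
  using proper[of i u] by (cases "f i u") (auto simp: dom_f_def rf_def)

lemma weighted_sum_eq_rf: "u \<in> D \<Longrightarrow> weighted_sum N f l u = ereal (\<Sum>i=1..N. l i * rf i u)"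
  by (simp add: weighted_sum_def f_eq_rf)

lemma weighted_sum_outside_dom:
  assumes "l \<in> open_simplex N" "u \<in> U" "u \<notin> D"
  shows "weighted_sum N f l u = \<infinity>"
proof -
  obtain i where i: "i \<in> {1..N}" "f i u = \<infinity>"
    using assms by (auto simp: dom_f_def)
  moreover have "0 < l i"
    using assms(1) i by (auto simp: open_simplex_def PiE_def Pi_def)
  ultimately show ?thesis
    by (auto simp: weighted_sum_def sum_Pinfty intro!: bexI[of _ i])
qed

text \<open>Discarding the points outside the domain makes every weighted sum a real affine function of
  the weight, defined beyond the simplex as well.\<close>

lemma weighted_value_eq_dom:
  assumes "l \<in> open_simplex N"
  shows "V U l = V D l"
  unfolding weighted_value_def
proof (rule antisym)
  show "(INF u\<in>U. weighted_sum N f l u) \<le> (INF u\<in>D. weighted_sum N f l u)"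
    by (rule INF_superset_mono) (auto simp: dom_f_def)
  show "(INF u\<in>D. weighted_sum N f l u) \<le> (INF u\<in>U. weighted_sum N f l u)"
    by (rule INF_greatest)
       (metis INF_lower assms ereal_less_eq(1) weighted_sum_outside_dom)
qed

lemma weighted_value_less_top: "V D l < \<infinity>"
proof -
  obtain u where u: "u \<in> D"
    using dom_nonempty by blast
  have "V D l \<le> weighted_sum N f l u"
    unfolding weighted_value_def using u by (rule INF_lower)
  then show ?thesis
    using weighted_sum_eq_rf[OF u] by auto
qed

lemma sum_eq_gap:
  assumes "l \<in> open_simplex N"
  shows "(\<Sum>i=1..N. l i * rf i u) = rf N u + (\<Sum>i\<in>{1..<N}. l i * gap i u)"
proof -
  have split: "(\<Sum>i=1..N. g i) = (\<Sum>i\<in>{1..<N}. g i) + g N" for g :: "nat \<Rightarrow> real"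
  proof -
    have "{1..N} = insert N {1..<N}"
      using two_objectives by auto
    then show ?thesis
      by simp
  qed
  have "l N = 1 - (\<Sum>i\<in>{1..<N}. l i)"
    using assms split[of l] by (simp add: open_simplex_def)
  then have "l N * rf N u = rf N u - (\<Sum>i\<in>{1..<N}. l i) * rf N u"
    by (simp add: left_diff_distrib)
  moreover have "(\<Sum>i\<in>{1..<N}. l i * gap i u) =
      (\<Sum>i\<in>{1..<N}. l i * rf i u) - (\<Sum>i\<in>{1..<N}. l i) * rf N u"
    by (simp add: gap_def right_diff_distrib sum_subtractf sum_distrib_right)
  ultimately show ?thesis
    using split[of "\<lambda>i. l i * rf i u"] by linarith
qed

text \<open>The infimum runs over a possibly uncountable set, so measurability comes from
  semicontinuity: the sublevel set is a union of open half-spaces. Openness lives in the full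
  product topology on \<open>nat \<Rightarrow> real\<close>, into which the finite product embeds measurably.\<close>

lemma weighted_value_measurable:
  assumes "S \<subseteq> D"
  shows "V S \<in> borel_measurable (Pi\<^sub>M {1..N} (\<lambda>_. borel))"
proof (rule borel_measurableI_less)
  fix c :: ereal
  let ?M = "Pi\<^sub>M {1..N} (\<lambda>_. borel :: real measure)"
  let ?O = "\<Union>u\<in>S. {l :: nat \<Rightarrow> real. ereal (\<Sum>i=1..N. l i * rf i u) < c}"
  have embed: "(\<lambda>l. l) \<in> ?M \<rightarrow>\<^sub>M borel"
  proof (rule measurable_coordinatewise_then_product)
    fix i
    show "(\<lambda>l. l i) \<in> borel_measurable ?M"
    proof (cases "i \<in> {1..N}")
      case False
      then have "(\<lambda>l. l i) \<in> borel_measurable ?M \<longleftrightarrow> (\<lambda>_. undefined :: real) \<in> borel_measurable ?M"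
        by (intro measurable_cong) (auto simp: space_PiM PiE_def extensional_def)
      then show ?thesis by simp
    qed simp
  qed
  have "open ?O"
    by (intro open_UN ballI open_Collect_less continuous_intros continuous_on_product_coordinates)
  then have "(\<lambda>l. l) -` ?O \<inter> space ?M \<in> sets ?M"
    by (intro measurable_sets[OF embed] borel_open)
  moreover have "{l \<in> space ?M. V S l < c} = (\<lambda>l. l) -` ?O \<inter> space ?M"
    using assms weighted_sum_eq_rf
    by (auto simp: weighted_value_def INF_less_iff subset_iff)
  ultimately show "{l \<in> space ?M. V S l < c} \<in> sets ?M"
    by simp
qed

section \<open>Weights whose value is reached within a given set\<close>

text \<open>The equation \<open>V S l = V D l\<close> says that \<open>S\<close> contains a minimizing sequence for \<open>l\<close>; stated
  through values it is visibly a measurable condition on \<open>l\<close>.\<close>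

definition tight :: "'a set \<Rightarrow> (nat \<Rightarrow> real) set" where
  "tight S = {l \<in> open_simplex N. V D l > -\<infinity> \<and> V S l = V D l}"

lemma tight_measurable:
  assumes "S \<subseteq> D"
  shows "tight S \<in> sets (Pi\<^sub>M {1..N} (\<lambda>_. borel))"
proof -
  let ?M = "Pi\<^sub>M {1..N} (\<lambda>_. borel :: real measure)"
  note meas = weighted_value_measurable[OF assms] weighted_value_measurable[OF order_refl]
  have "tight S = open_simplex N \<inter> {l \<in> space ?M. V D l > -\<infinity> \<and> V S l = V D l}"
    using sets.sets_into_space[OF open_simplex_sets[of N]] by (auto simp: tight_def)
  also have "\<dots> \<in> sets ?M"
    by (intro sets.Int open_simplex_sets sets.sets_Collect_conj borel_measurable_less
        borel_measurable_const meas borel_measurable_eq)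
  finally show ?thesis .
qed

lemma tight_value_finite:
  assumes "l \<in> tight S"
  obtains v where "V D l = ereal v"
  using assms weighted_value_less_top[of l] by (cases "V D l") (auto simp: tight_def)

text \<open>Since \<open>S\<close> contains almost optimal points for \<open>l\<close>, testing the infimum at \<open>l'\<close> with them
  costs at most the change of their weighted sums. That change is exact, not just first order,
  because the sums are affine in the weight.\<close>

lemma value_change_le:
  assumes S: "S \<subseteq> D" and l: "l \<in> tight S" and l': "l' \<in> open_simplex N"
    and j: "j \<in> {1..<N}" and same: "\<forall>i\<in>{1..<N} - {j}. l' i = l i"
    and c: "\<And>u. u \<in> S \<Longrightarrow> (l' j - l j) * gap j u \<le> c"
  shows "V D l' \<le> V D l + ereal c"
proof -
  have l_simplex: "l \<in> open_simplex N"
    using l by (simp add: tight_def)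
  have "V D l' - ereal c \<le> weighted_sum N f l u" if u: "u \<in> S" for u
  proof -
    have diff: "(\<Sum>i\<in>{1..<N}. l' i * gap i u) - (\<Sum>i\<in>{1..<N}. l i * gap i u) = (l' j - l j) * gap j u"
      using j same by (simp add: sum.remove[of _ j] left_diff_distrib)
    have "V D l' \<le> weighted_sum N f l' u"
      unfolding weighted_value_def using S u by (intro INF_lower) auto
    also have "\<dots> \<le> weighted_sum N f l u + ereal c"
    proof -
      have "(\<Sum>i=1..N. l' i * rf i u) \<le> (\<Sum>i=1..N. l i * rf i u) + c"
        unfolding sum_eq_gap[OF l_simplex] sum_eq_gap[OF l'] using c[OF u] diff by linarith
      then show ?thesis
        using S u weighted_sum_eq_rf by (simp add: subset_iff del: One_nat_def)
    qed
    finally show ?thesis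
      by (simp add: ereal_minus_le_iff add.commute)
  qed
  then have "V D l' - ereal c \<le> V S l"
    unfolding weighted_value_def by (intro INF_greatest)
  then show ?thesis
    using l by (simp add: tight_def ereal_minus_le_iff add.commute)
qed

text \<open>Along a line the optimal slopes of an infimum of affine functions decrease: going up from a
  weight that admits slopes at most \<open>p\<close>, no weight admitting slopes at least \<open>q > p\<close> can follow.\<close>

lemma null_slope_jump:
  assumes j: "j \<in> {1..<N}" and pq: "p < q"
  shows "tight {u \<in> D. gap j u \<le> p} \<inter> tight {u \<in> D. q \<le> gap j u} \<in> null_sets (simplex_measure N)"
    (is "tight ?L \<inter> tight ?R \<in> _")
proof (rule null_sets_simplex_measure_if_thin_lines[OF _ _ j])
  show "tight ?L \<inter> tight ?R \<in> sets (Pi\<^sub>M {1..N} (\<lambda>_. borel))"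
    by (intro sets.Int tight_measurable) auto
  show "tight ?L \<inter> tight ?R \<subseteq> open_simplex N"
    by (auto simp: tight_def)
  fix l l'
  assume l: "l \<in> tight ?L \<inter> tight ?R" and l': "l' \<in> tight ?L \<inter> tight ?R"
    and same: "\<forall>i\<in>{1..<N} - {j}. l' i = l i"
  show "\<not> l j < l' j"
  proof
    assume less: "l j < l' j"
    obtain v where v: "V D l = ereal v"
      by (rule tight_value_finite[OF IntD1[OF l]])
    obtain v' where v': "V D l' = ereal v'"
      by (rule tight_value_finite[OF IntD1[OF l']])
    have same': "\<forall>i\<in>{1..<N} - {j}. l i = l' i"
      using same by simp
    have simplex: "l \<in> open_simplex N" "l' \<in> open_simplex N"
      using l l' by (auto simp: tight_def)
    have "V D l' \<le> V D l + ereal ((l' j - l j) * p)"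
      by (rule value_change_le[of ?L])
         (use l simplex less j same in \<open>auto intro: mult_left_mono simp del: One_nat_def\<close>)
    moreover have "V D l \<le> V D l' + ereal ((l j - l' j) * q)"
      by (rule value_change_le[of ?R])
         (use l' simplex less j same' in \<open>auto intro: mult_left_mono_neg simp del: One_nat_def\<close>)
    ultimately have "(l' j - l j) * (q - p) \<le> 0"
      by (simp add: v v' algebra_simps)
    with less pq show False
      by (simp add: mult_le_0_iff)
  qed
qed

text \<open>Arbitrarily steep near-minimizers at \<open>l\<close> force \<open>V = -\<infinity>\<close> on one side of \<open>l\<close> along the line, so
  such a weight is an endpoint of the interval where \<open>V\<close> is finite; the sign \<open>s\<close> selects which
  endpoint.\<close>

lemma null_steep:
  assumes j: "j \<in> {1..<N}" and s: "s = 1 \<or> s = -1"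
  shows "(\<Inter>n :: nat. tight {u \<in> D. real n \<le> s * gap j u}) \<in> null_sets (simplex_measure N)"
    (is "(\<Inter>n. tight (?S n)) \<in> _")
proof (rule null_sets_simplex_measure_if_thin_lines[OF _ _ j])
  show "(\<Inter>n. tight (?S n)) \<in> sets (Pi\<^sub>M {1..N} (\<lambda>_. borel))"
    using tight_measurable[of "?S n" for n] by (intro sets.countable_INT) auto
  show "(\<Inter>n. tight (?S n)) \<subseteq> open_simplex N"
    by (auto simp: tight_def)
  have impossible: "\<not> 0 < s * (l j - l' j)"
    if l: "l \<in> (\<Inter>n. tight (?S n))" and l': "l' \<in> (\<Inter>n. tight (?S n))"
      and same: "\<forall>i\<in>{1..<N} - {j}. l' i = l i" for l l'
  proof
    assume pos: "0 < s * (l j - l' j)"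
    obtain v where v: "V D l = ereal v"
      by (rule tight_value_finite[OF INT_D[OF l UNIV_I]])
    obtain v' where v': "V D l' = ereal v'"
      by (rule tight_value_finite[OF INT_D[OF l' UNIV_I]])
    obtain n :: nat where n: "v - v' < real n * (s * (l j - l' j))"
      using reals_Archimedean3[OF pos] by blast
    have "V D l' \<le> V D l + ereal (- (s * (l j - l' j) * real n))"
    proof (rule value_change_le[of "?S n"])
      fix u
      assume "u \<in> ?S n"
      then have "s * (l j - l' j) * real n \<le> s * (l j - l' j) * (s * gap j u)"
        using pos by (intro mult_left_mono) auto
      also have "\<dots> = (l j - l' j) * gap j u"
        using s by auto
      finally show "(l' j - l j) * gap j u \<le> - (s * (l j - l' j) * real n)"
        by (simp add: algebra_simps)
    qed (use l l' j same in \<open>auto simp: tight_def simp del: One_nat_def\<close>)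
    with n show False
      by (simp add: v v' algebra_simps)
  qed
  fix l l'
  assume "l \<in> (\<Inter>n. tight (?S n))" "l' \<in> (\<Inter>n. tight (?S n))" "\<forall>i\<in>{1..<N} - {j}. l' i = l i"
  then show "\<not> l j < l' j"
    using impossible[of l l'] impossible[of l' l] s by auto
qed

section \<open>Convergence along near-minimizers\<close>

text \<open>All minimizing sequences converge to this one filter, so a limit along it is automatically
  common to all of them.\<close>

definition near_minimizers :: "(nat \<Rightarrow> real) \<Rightarrow> 'a filter" where
  "near_minimizers l = inf (filtercomap (weighted_sum N f l) (nhds (V D l))) (principal D)"

lemma minimizing_seq_filterlim:
  assumes l: "l \<in> open_simplex N" and u: "minimizing_seq N U f l u"
  shows "filterlim u (near_minimizers l) sequentially"
proof -
  have lim: "(\<lambda>k. weighted_sum N f l (u k)) \<longlonglongrightarrow> V D l" and in_U: "\<And>k. u k \<in> U"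
    using u by (auto simp: minimizing_seq_def weighted_value_eq_dom[OF l])
  have "\<forall>\<^sub>F k in sequentially. weighted_sum N f l (u k) < \<infinity>"
    using lim weighted_value_less_top by (rule order_tendstoD)
  then have "\<forall>\<^sub>F k in sequentially. u k \<in> D"
    by eventually_elim (use weighted_sum_outside_dom[OF l] in_U in \<open>metis less_irrefl\<close>)
  with lim show ?thesis
    by (simp add: near_minimizers_def filterlim_inf filterlim_principal filterlim_filtercomap_iff o_def)
qed

lemma minimizing_seq_exists: "\<exists>u. minimizing_seq N U f l u"
proof -
  have "weighted_sum N f l ` U \<noteq> {}"
    using dom_nonempty by (auto simp: dom_f_def)
  from Inf_as_limit[OF this] obtain h
    where h: "\<And>n. h n \<in> weighted_sum N f l ` U" "h \<longlonglongrightarrow> V U l"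
    by (auto simp: weighted_value_def)
  from h(1) have "\<forall>n. \<exists>u\<in>U. h n = weighted_sum N f l u"
    by blast
  then obtain u where u: "\<And>n. u n \<in> U" "\<And>n. h n = weighted_sum N f l (u n)"
    by metis
  have "h = (\<lambda>n. weighted_sum N f l (u n))"
    using u(2) by blast
  with h(2) u(1) show ?thesis
    by (auto simp: minimizing_seq_def)
qed

lemma near_minimizers_nontrivial:
  assumes "l \<in> open_simplex N"
  shows "near_minimizers l \<noteq> bot"
proof
  assume bot: "near_minimizers l = bot"
  obtain u where "minimizing_seq N U f l u"
    using minimizing_seq_exists by blast
  from minimizing_seq_filterlim[OF assms this] show False
    by (simp add: bot filterlim_def filtermap_bot_iff bot_unique)
qed

lemma eventually_not_in_if_not_tight:
  assumes l: "l \<in> open_simplex N" "V D l > -\<infinity>" and S: "S \<subseteq> D" "l \<notin> tight S"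
  shows "\<forall>\<^sub>F u in near_minimizers l. u \<notin> S"
proof -
  have "V D l \<le> V S l"
    unfolding weighted_value_def using S(1) by (intro INF_superset_mono) auto
  then have "V D l < V S l"
    using l S(2) by (auto simp: tight_def)
  then have "\<forall>\<^sub>F x in nhds (V D l). x < V S l"
    by (rule order_tendstoD(2)[OF filterlim_ident])
  then have "\<forall>\<^sub>F u in near_minimizers l. weighted_sum N f l u < V S l"
    unfolding near_minimizers_def
    by (intro filter_leD[OF inf_le1]) (auto simp: eventually_filtercomap)
  then show ?thesis
  proof eventually_elim
    case (elim u)
    have "V S l \<le> weighted_sum N f l u" if "u \<in> S"
      unfolding weighted_value_def using that by (rule INF_lower)
    with elim show ?case
      by (auto simp: not_less[symmetric])
  qed
qed

text \<open>For rationals \<open>p < q\<close>, the absence of a jump says that \<open>p\<close> is eventually a strict lower bound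
  of the gap or \<open>q\<close> a strict upper bound. The eventual lower bounds form a nonempty set bounded above because there is no
  steepness, and their supremum is the limit.\<close>

lemma near_minimizers_gap_converges:
  assumes l: "l \<in> open_simplex N" "V D l > -\<infinity>"
    and no_jump: "\<And>p q :: rat. p < q \<Longrightarrow>
      l \<notin> tight {u \<in> D. gap j u \<le> of_rat p} \<inter> tight {u \<in> D. of_rat q \<le> gap j u}"
    and no_steep: "\<And>s. s = 1 \<or> s = -1 \<Longrightarrow> l \<notin> (\<Inter>n :: nat. tight {u \<in> D. real n \<le> s * gap j u})"
  shows "\<exists>d. (gap j \<longlongrightarrow> d) (near_minimizers l)"
proof -
  let ?F = "near_minimizers l"
  define P where "P = {p. \<forall>\<^sub>F u in ?F. p < gap j u}"
  define Q where "Q = {q. \<forall>\<^sub>F u in ?F. gap j u < q}"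
  have in_D: "\<forall>\<^sub>F u in ?F. u \<in> D"
    unfolding near_minimizers_def by (simp add: eventually_inf_principal)
  have avoid: "\<forall>\<^sub>F u in ?F. \<not> R u" if "l \<notin> tight {u \<in> D. R u}" for R
  proof -
    have "\<forall>\<^sub>F u in ?F. u \<notin> {u \<in> D. R u}"
      by (rule eventually_not_in_if_not_tight[OF l _ that]) auto
    with in_D show ?thesis
      by eventually_elim auto
  qed
  obtain n m :: nat where n: "l \<notin> tight {u \<in> D. real n \<le> gap j u}"
      and m: "l \<notin> tight {u \<in> D. real m \<le> - gap j u}"
    using no_steep[of 1] no_steep[of "-1"] by auto
  have Q: "real n \<in> Q"
    using avoid[OF n] by (simp add: Q_def not_le)
  have P: "- real m \<in> P"
    using avoid[OF m] by (auto simp: P_def not_le elim: eventually_mono)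
  have PQ: "p < q" if "p \<in> P" "q \<in> Q" for p q
  proof -
    have "\<forall>\<^sub>F u in ?F. p < q"
      using that unfolding P_def Q_def mem_Collect_eq by eventually_elim auto
    then show ?thesis
      using near_minimizers_nontrivial[OF l(1)] by (simp add: eventually_const_iff)
  qed
  have bdd: "bdd_above P"
    using PQ[OF _ Q] by (intro bdd_aboveI[of _ "real n"]) force
  have "(gap j \<longlongrightarrow> Sup P) ?F"
  proof (rule order_tendstoI)
    fix a
    assume "a < Sup P"
    then obtain p where "p \<in> P" "a < p"
      using less_cSup_iff[OF _ bdd] P by blast
    then show "\<forall>\<^sub>F u in ?F. a < gap j u"
      unfolding P_def by (auto elim: eventually_mono)
  next
    fix a
    assume "Sup P < a"
    \<comment> \<open>With two rationals between \<open>Sup P\<close> and \<open>a\<close>, \<open>p\<close> fails to be a lower bound, so \<open>q\<close> must be an upper bound.\<close>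
    then obtain p where p: "Sup P < of_rat p" "of_rat p < a"
      using of_rat_dense by blast
    then obtain q where q: "of_rat p < (of_rat q :: real)" "of_rat q < a"
      using of_rat_dense by blast
    have "of_rat p \<notin> P"
      using p(1) cSup_upper[OF _ bdd] by force
    then have "l \<in> tight {u \<in> D. gap j u \<le> of_rat p}"
      using avoid[of "\<lambda>u. gap j u \<le> of_rat p"] by (auto simp: P_def not_le)
    then have "l \<notin> tight {u \<in> D. of_rat q \<le> gap j u}"
      using no_jump[of p q] q(1) by (auto simp: of_rat_less)
    from avoid[OF this] show "\<forall>\<^sub>F u in ?F. gap j u < a"
      by (rule eventually_mono) (use q(2) in auto)
  qed
  then show ?thesis ..
qed

text \<open>Finiteness of the limiting gaps matters here: it allows the last objective to be recovered by
  subtraction from the weighted sum, which tends to the finite value.\<close>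

lemma near_minimizers_objectives_converge:
  assumes l: "l \<in> open_simplex N" "V D l > -\<infinity>"
    and gaps: "\<And>j. j \<in> {1..<N} \<Longrightarrow> \<exists>d. (gap j \<longlongrightarrow> d) (near_minimizers l)"
  shows "\<exists>y. \<forall>i\<in>{1..N}. (f i \<longlongrightarrow> y i) (near_minimizers l)"
proof -
  let ?F = "near_minimizers l"
  obtain d where d: "\<And>j. j \<in> {1..<N} \<Longrightarrow> (gap j \<longlongrightarrow> d j) ?F"
    using gaps by metis
  obtain v where v: "V D l = ereal v"
    using l(2) weighted_value_less_top[of l] by (cases "V D l") auto
  have in_D: "\<forall>\<^sub>F u in ?F. u \<in> D"
    unfolding near_minimizers_def by (simp add: eventually_inf_principal)
  have "(weighted_sum N f l \<longlongrightarrow> ereal v) ?F"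
    unfolding near_minimizers_def v[symmetric]
    by (intro filterlim_mono[OF filterlim_filtercomap]) auto
  moreover have "\<forall>\<^sub>F u in ?F. weighted_sum N f l u = ereal (\<Sum>i=1..N. l i * rf i u)"
    using in_D by eventually_elim (rule weighted_sum_eq_rf)
  ultimately have "((\<lambda>u. ereal (\<Sum>i=1..N. l i * rf i u)) \<longlongrightarrow> ereal v) ?F"
    by (rule Lim_transform_eventually)
  then have "((\<lambda>u. (\<Sum>i=1..N. l i * rf i u) - (\<Sum>j\<in>{1..<N}. l j * gap j u)) \<longlongrightarrow>
      v - (\<Sum>j\<in>{1..<N}. l j * d j)) ?F"
    by (intro tendsto_intros d) auto
  then have last: "(rf N \<longlongrightarrow> v - (\<Sum>j\<in>{1..<N}. l j * d j)) ?F"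
    unfolding sum_eq_gap[OF l(1)] by simp
  have "\<exists>c. (f i \<longlongrightarrow> c) ?F" if i: "i \<in> {1..N}" for i
  proof -
    have "\<exists>c. (rf i \<longlongrightarrow> c) ?F"
    proof (cases "i = N")
      case False
      then have "((\<lambda>u. gap i u + rf N u) \<longlongrightarrow> d i + (v - (\<Sum>j\<in>{1..<N}. l j * d j))) ?F"
        using i by (intro tendsto_add d last) auto
      then show ?thesis
        by (auto simp: gap_def)
    qed (use last in auto)
    then obtain c where "((\<lambda>u. ereal (rf i u)) \<longlongrightarrow> ereal c) ?F"
      by auto
    moreover have "\<forall>\<^sub>F u in ?F. ereal (rf i u) = f i u"
      using in_D by eventually_elim (rule f_eq_rf[OF _ i, symmetric])
    ultimately show ?thesis
      by (blast intro: Lim_transform_eventually)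
  qed
  then show ?thesis
    by metis
qed

lemma unique_limit_vector:
  assumes l: "l \<in> open_simplex N"
    and lim: "\<forall>i\<in>{1..N}. (f i \<longlongrightarrow> y i) (near_minimizers l)"
  shows "\<exists>!y. y \<in> {1..N} \<rightarrow>\<^sub>E (UNIV :: ereal set) \<and>
    (\<forall>u. minimizing_seq N U f l u \<longrightarrow> (\<forall>i\<in>{1..N}. (\<lambda>k. f i (u k)) \<longlonglongrightarrow> y i))"
proof (rule ex1I[of _ "restrict y {1..N}"])
  have conv: "(\<lambda>k. f i (u k)) \<longlonglongrightarrow> y i" if "minimizing_seq N U f l u" "i \<in> {1..N}" for u i
    using filterlim_compose[OF _ minimizing_seq_filterlim[OF l that(1)]] lim that(2) by blast
  then show "restrict y {1..N} \<in> {1..N} \<rightarrow>\<^sub>E UNIV \<and>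
    (\<forall>u. minimizing_seq N U f l u \<longrightarrow>
      (\<forall>i\<in>{1..N}. (\<lambda>k. f i (u k)) \<longlonglongrightarrow> restrict y {1..N} i))"
    by simp
  fix z
  assume z: "z \<in> {1..N} \<rightarrow>\<^sub>E (UNIV :: ereal set) \<and>
    (\<forall>u. minimizing_seq N U f l u \<longrightarrow> (\<forall>i\<in>{1..N}. (\<lambda>k. f i (u k)) \<longlonglongrightarrow> z i))"
  obtain u where u: "minimizing_seq N U f l u"
    using minimizing_seq_exists by blast
  show "z = restrict y {1..N}"
  proof (rule PiE_ext[of _ "{1..N}" "\<lambda>_. UNIV"])
    fix i
    assume i: "i \<in> {1..N}"
    then have "(\<lambda>k. f i (u k)) \<longlonglongrightarrow> z i"
      using z u by blast
    then show "z i = restrict y {1..N} i"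
      using LIMSEQ_unique conv[OF u i] i by fastforce
  qed (use z in auto)
qed

section \<open>Almost every weight\<close>

lemma AE_gaps_converge:
  assumes j: "j \<in> {1..<N}"
  shows "AE l in simplex_measure N. V D l > -\<infinity> \<longrightarrow> (\<exists>d. (gap j \<longlongrightarrow> d) (near_minimizers l))"
proof -
  have "AE l in simplex_measure N. \<forall>p q :: rat. p < q \<longrightarrow>
      l \<notin> tight {u \<in> D. gap j u \<le> of_rat p} \<inter> tight {u \<in> D. of_rat q \<le> gap j u}"
    unfolding AE_all_countable
    by (intro allI) (use AE_not_in[OF null_slope_jump[OF j]] in \<open>simp add: of_rat_less\<close>)
  moreover have "AE l in simplex_measure N. l \<notin> (\<Inter>n :: nat. tight {u \<in> D. real n \<le> 1 * gap j u})"
    by (intro AE_not_in null_steep[OF j]) simp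
  moreover have "AE l in simplex_measure N. l \<notin> (\<Inter>n :: nat. tight {u \<in> D. real n \<le> -1 * gap j u})"
    by (intro AE_not_in null_steep[OF j]) simp
  moreover have "AE l in simplex_measure N. l \<in> open_simplex N"
    using AE_space[of "simplex_measure N"] by (simp only: space_simplex_measure)
  ultimately show ?thesis
  proof eventually_elim
    case (elim l)
    show ?case
      by (intro impI near_minimizers_gap_converges) (use elim in blast)+
  qed
qed

end

theorem theorem3p2:
  fixes N :: nat and U :: "'a set" and f :: "nat \<Rightarrow> 'a \<Rightarrow> ereal"
  assumes "N \<ge> 2"
    and "U \<noteq> {}"
    and "\<And>i u. i \<in> {1..N} \<Longrightarrow> u \<in> U \<Longrightarrow> f i u \<noteq> -\<infinity>"
    and "dom_f N U f \<noteq> {}"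
  shows "AE l in simplex_measure N.
    weighted_value N U f l > -\<infinity> \<longrightarrow>
      (\<exists>!y. y \<in> {1..N} \<rightarrow>\<^sub>E (UNIV :: ereal set) \<and>
         (\<forall>u. minimizing_seq N U f l u \<longrightarrow>
            (\<forall>i\<in>{1..N}. (\<lambda>k. f i (u k)) \<longlonglongrightarrow> y i)))"
proof -
  interpret weighted_objectives N U f
    using assms by unfold_locales
  have "AE l in simplex_measure N. \<forall>j\<in>{1..<N}.
      V D l > -\<infinity> \<longrightarrow> (\<exists>d. (gap j \<longlongrightarrow> d) (near_minimizers l))"
    by (intro AE_finite_allI AE_gaps_converge) auto
  moreover have "AE l in simplex_measure N. l \<in> open_simplex N"
    using AE_space[of "simplex_measure N"] by (simp only: space_simplex_measure)
  ultimately show ?thesis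
  proof eventually_elim
    case (elim l)
    show ?case
    proof
      assume "V U l > -\<infinity>"
      then have finite: "V D l > -\<infinity>"
        using weighted_value_eq_dom[OF elim(2)] by simp
      then obtain y where "\<forall>i\<in>{1..N}. (f i \<longlongrightarrow> y i) (near_minimizers l)"
        using near_minimizers_objectives_converge[OF elim(2) finite] elim(1) by blast
      then show "\<exists>!y. y \<in> {1..N} \<rightarrow>\<^sub>E (UNIV :: ereal set) \<and>
          (\<forall>u. minimizing_seq N U f l u \<longrightarrow> (\<forall>i\<in>{1..N}. (\<lambda>k. f i (u k)) \<longlonglongrightarrow> y i))"
        by (rule unique_limit_vector[OF elim(2)])
    qed
  qed
qed

end
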